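(* Let $t\in\{2,\dots,T\}$, $K_t\ge 1$, and let $\{(\pi_t^k,\gamma_t^k)\}_{k=1}^{K_t}$ be coefficients of valid cuts for $\mathcal{Q}^{RR}_{t+1}$, i.e. $\mathcal{Q}^{RR}_{t+1}(x_t)\ge(\pi_t^k)^\top x_t+\gamma_t^k$ for all $x_t\in\mathcal{X}_t$ and all $k\in\{1,\dots,K_t\}$. Consider the system, in the variables $\rho_t\in\mathbb{R}$ and $\lambda_t^i,\mu_t^i,\nu_t^i\in\mathbb{R}^{d_\omega}$, $\zeta_t^i\in\mathbb{R}^{K_t}$ ($i=1,\dots,N_t$): $$(\ast)\quad\begin{cases}A_t^\top\lambda_t^i-\sum_{k=1}^{K_t}\zeta_{tk}^i\pi_t^k=c_t, & i=1,\dots,N_t,\\ \|\lambda_t^i-\mu_t^i+\nu_t^i\|_*\le\rho_t, & i=1,\dots,N_t,\\ \sum_{k=1}^{K_t}\zeta_{tk}^i=1, & i=1,\dots,N_t,\\ \rho_t\ge0,\ (\lambda_t^i,\mu_t^i,\nu_t^i,\zeta_t^i)\ge0, & i=1,\dots,N_t,\end{cases}$$ where $\|\cdot\|_*$ is the dual norm of $\|\cdot\|$. (a) For any parameters $(\rho_t,\{\lambda_t^i,\mu_t^i,\nu_t^i,\zeta_t^i\}_{i=1}^{N_t})$ satisfying $(\ast)$ and every $x_{t-1}\in\mathcal{X}_{t-1}$, $$\mathcal{Q}^{RR}_t(x_{t-1})\ \ge\ -\epsilon_t(x_{t-1})\rho_t+\sum_{i=1}^{N_t}\frac1{N_t}\Big((-\lambda_t^i)^\top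 C_tx_{t-1}+(\mu_t^i)^\top l_t-(\nu_t^i)^\top u_t+(\lambda_t^i-\mu_t^i+\nu_t^i)^\top\omega_t^i+\sum_{k=1}^{K_t}\zeta_{tk}^i\gamma_t^k\Big).$$ (b) For given $x_{t-1}$, the strongest (largest at $x_{t-1}$) lower bound of the form in (a) is obtained by solving $$\max\Big\{-\epsilon_t(x_{t-1})\rho_t+\frac1{N_t}\sum_{i=1}^{N_t}\Big((-\lambda_t^i)^\top C_tx_{t-1}+(\mu_t^i)^\top l_t-(\nu_t^i)^\top u_t+(\lambda_t^i-\mu_t^i+\nu_t^i)^\top\omega_t^i+\sum_{k=1}^{K_t}\zeta_{tk}^i\gamma_t^k\Big):\ (\ast)\Big\}.$$
   Context: Distributionally risk-receptive multistage stochastic integer program with $T$ stages, continuous supports and decision-dependent Wasserstein ambiguity sets. $x_t\in\mathbb{R}^{d_x}$ denotes the vector of all decision variables of stage $t$, and $\mathcal{X}_t\subseteq\mathbb{R}^{d_x}$ is the set defined by the integrality constraints on $x_t$. For $t\in\{2,\dots,T\}$, $\boldsymbol{\omega}_t$ is a random vector with support the bounded hyperrectangle $\Omega_t=\{\omega\in\mathbb{R}^{d_\omega}: l_t\le\omega\le u_t\}$ (componentwise, $l_t,u_t\in\mathbb{R}^{d_\omega}$), and random vectors are stage-wise independent. Data points $\omega_t^1,\dots,\omega_t^{N_t}\in\Omega_t$ are given and $\bar P_t=\frac1{N_t}\sum_{i=1}^{N_t}\delta_{\omega_t^i}$. Randomness appears only in the right-hand side of the constraints: $X_t(x_{t-1},\omega_t)=\{x_t\in\mathcal{X}_t:\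 A_tx_t\ge\omega_t-C_tx_{t-1}\}$, which is nonempty and compact for all admissible $x_{t-1}\in\mathcal{X}_{t-1}$ and $\omega_t\in\Omega_t$; the stage cost is linear, $c_t^\top x_t$. The ambiguity set is $\mathcal{P}_t(x_{t-1})=\{P_t\in\mathcal{M}(\Omega_t):\mathcal{W}(P_t,\bar P_t)\le\epsilon_t(x_{t-1})\}$, where $\mathcal{M}(\Omega_t)$ is the set of all probability distributions supported on $\Omega_t$, the radius $\epsilon_t:\mathcal{X}_{t-1}\to\mathbb{R}_+$ is an affine function, and $\mathcal{W}$ is the 1-Wasserstein distance with respect to an arbitrary norm $\|\cdot\|$ on $\mathbb{R}^{d_\omega}$ (infimum of $\mathbb{E}_P\|\omega_t-\omega_t'\|$ over joint distributions $P$ on $\Omega_t\times\Omega_t$ with marginals $P_t$ and $\bar P_t$). The cost-to-go functions are defined recursively for $t=T,\dots,2$ by $$Q_t^{RR}(x_{t-1},\omega_t)=\min_{x_t\in X_t(x_{t-1},\omega_t)}\big\{c_t^\top x_t+\mathcal{Q}^{RR}_{t+1}(x_t)\big\},\qquad \mathcal{Q}^{RR}_t(x_{t-1})=\min_{P_t\in\mathcal{P}_t(x_{t-1})}\mathbb{E}_{P_t}[Q^{RR}_t(x_{t-1},\boldsymbol{\omega}_t)],\qquad \mathcal{Q}^{RR}_{T+1}=0.$$ "min" and "max" denote optimal values. *)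

theory Defs
  imports "HOL-Probability.Probability"
begin

definition is_norm :: "(real ^ 'w::finite \<Rightarrow> real) \<Rightarrow> bool" where
  "is_norm N \<longleftrightarrow>
     (\<forall>v. N v = 0 \<longleftrightarrow> v = 0) \<and>
     (\<forall>a v. N (a *\<^sub>R v) = \<bar>a\<bar> * N v) \<and>
     (\<forall>v w. N (v + w) \<le> N v + N w)"

definition dual_norm :: "(real ^ 'w::finite \<Rightarrow> real) \<Rightarrow> real ^ 'w \<Rightarrow> real" where
  "dual_norm N y = (SUP z\<in>{z. N z \<le> 1}. y \<bullet> z)"


subsection \<open>Probability distributions and the Wasserstein distance\<close>

definition distributions_on :: "(real ^ 'w::finite) set \<Rightarrow> (real ^ 'w) measure set" where
  "distributions_on S = {P. prob_space P \<and> sets P = sets borel \<and> emeasure P S = 1}"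

definition couplings ::
  "(real ^ 'w::finite) set \<Rightarrow> (real ^ 'w) measure \<Rightarrow> (real ^ 'w) measure
     \<Rightarrow> ((real ^ 'w) \<times> (real ^ 'w)) measure set" where
  "couplings S P P' = {J. prob_space J \<and> sets J = sets (borel \<Otimes>\<^sub>M borel) \<and>
     emeasure J (S \<times> S) = 1 \<and> distr J borel fst = P \<and> distr J borel snd = P'}"

definition wasserstein ::
  "(real ^ 'w::finite \<Rightarrow> real) \<Rightarrow> (real ^ 'w) set \<Rightarrow> (real ^ 'w) measure \<Rightarrow> (real ^ 'w) measure
     \<Rightarrow> ennreal" where
  "wasserstein N S P P' =
     (INF J\<in>couplings S P P'. \<integral>\<^sup>+ z. ennreal (N (fst z - snd z)) \<partial>J)"

definition empirical :: "nat \<Rightarrow> (nat \<Rightarrow> real ^ 'w::finite) \<Rightarrow> (real ^ 'w) measure" where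
  "empirical n w = distr (uniform_count_measure {1..n}) borel w"

lemma emeasure_empirical:
  assumes "n \<ge> 1" "B \<in> sets borel"
  shows "emeasure (empirical n w) B = (\<Sum>i=1..n. ennreal (1 / n) * emeasure (return borel (w i)) B)"
proof -
  have "emeasure (empirical n w) B = emeasure (uniform_count_measure {1..n}) {i\<in>{1..n}. w i \<in> B}"
    unfolding empirical_def using assms
    by (subst emeasure_distr)
       (auto simp: space_uniform_count_measure sets_uniform_count_measure measurable_def
             intro!: arg_cong2[where f = emeasure])
  also have "\<dots> = ennreal (card {i\<in>{1..n}. w i \<in> B} / n)"
    by (subst emeasure_uniform_count_measure) auto
  also have "\<dots> = ennreal (\<Sum>i=1..n. 1 / n * indicator B (w i))"
  proof -
    have "(\<Sum>i=1..n. 1 / real n * indicator B (w i)) = (\<Sum>i\<in>{i\<in>{1..n}. w i \<in> B}. 1 / real n)"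
      by (intro sum.mono_neutral_cong_right) (auto simp: indicator_def)
    also have "\<dots> = card {i\<in>{1..n}. w i \<in> B} / n"
      by simp
    finally show ?thesis by (simp only:)
  qed
  also have "\<dots> = (\<Sum>i=1..n. ennreal (1 / n) * emeasure (return borel (w i)) B)"
  proof -
    have "ennreal (1 / n) * emeasure (return borel (w i)) B = ennreal (1 / n * indicator B (w i))" for i
      using assms by (simp add: indicator_def)
    then show ?thesis by (simp only:) (rule sum_ennreal[symmetric], simp)
  qed
  finally show ?thesis .
qed

text \<open>Expectation of an extended-real function as the integral of its positive part minus that
  of its negative part (\<^const>\<open>e2ennreal\<close> sends negative numbers to 0). Unlike the Bochner integral,
  it has no default value 0 for functions that are not integrable.\<close>

definition expect :: "'a measure \<Rightarrow> ('a \<Rightarrow> ereal) \<Rightarrow> ereal" where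
  "expect P f = enn2ereal (\<integral>\<^sup>+ w. e2ennreal (f w) \<partial>P) - enn2ereal (\<integral>\<^sup>+ w. e2ennreal (- f w) \<partial>P)"

lemma expect_eq_integral:
  assumes "integrable P f"
  shows "expect P (\<lambda>w. ereal (f w)) = ereal (integral\<^sup>L P f)"
proof -
  have e: "e2ennreal (ereal a) = ennreal a" for a
    by (simp add: ennreal.abs_eq e2ennreal_def)
  have fin: "(\<integral>\<^sup>+ w. ennreal (f w) \<partial>P) \<noteq> \<infinity>" "(\<integral>\<^sup>+ w. ennreal (- f w) \<partial>P) \<noteq> \<infinity>"
    using assms by (auto simp: real_integrable_def)
  have *: "enn2ereal a = ereal (enn2real a)" if "a \<noteq> \<infinity>" for a
    using that by (cases a) (auto simp: enn2ereal_ennreal)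
  show ?thesis
    unfolding expect_def real_lebesgue_integral_def[OF assms]
    by (simp only: uminus_ereal.simps(1) e *[OF fin(1)] *[OF fin(2)] ereal_minus(1))
qed


subsection \<open>The multistage stochastic integer program\<close>

text \<open>Stage data are indexed by the stage number, samples by \<open>1, \<dots>, num_samples t\<close>. The set
  \<open>dom_set t\<close> consists of the stage-\<open>t\<close> vectors that satisfy the integrality constraints;
  \<open>int_idx t\<close> lists the integer components.\<close>

record ('n, 'w) drmsip =
  horizon :: nat
  int_idx :: "nat \<Rightarrow> 'n set"
  dom_set :: "nat \<Rightarrow> (real ^ 'n) set"
  cost :: "nat \<Rightarrow> real ^ 'n"
  mat_A :: "nat \<Rightarrow> real ^ 'n ^ 'w"
  mat_C :: "nat \<Rightarrow> real ^ 'n ^ 'w"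
  lower :: "nat \<Rightarrow> real ^ 'w"
  upper :: "nat \<Rightarrow> real ^ 'w"
  num_samples :: "nat \<Rightarrow> nat"
  sample :: "nat \<Rightarrow> nat \<Rightarrow> real ^ 'w"
  radius :: "nat \<Rightarrow> real ^ 'n \<Rightarrow> real"
  wnorm :: "real ^ 'w \<Rightarrow> real"

definition support :: "('n::finite, 'w::finite) drmsip \<Rightarrow> nat \<Rightarrow> (real ^ 'w) set" where
  "support D t = {w. \<forall>j. lower D t $ j \<le> w $ j \<and> w $ j \<le> upper D t $ j}"

definition feasible ::
  "('n::finite, 'w::finite) drmsip \<Rightarrow> nat \<Rightarrow> real ^ 'n \<Rightarrow> real ^ 'w \<Rightarrow> (real ^ 'n) set" where
  "feasible D t x w =
     {y \<in> dom_set D t. \<forall>j. (mat_A D t *v y) $ j \<ge> (w - mat_C D t *v x) $ j}"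

definition ambiguity ::
  "('n::finite, 'w::finite) drmsip \<Rightarrow> nat \<Rightarrow> real ^ 'n \<Rightarrow> (real ^ 'w) measure set" where
  "ambiguity D t x = {P \<in> distributions_on (support D t).
     wasserstein (wnorm D) (support D t) P (empirical (num_samples D t) (sample D t))
       \<le> ennreal (radius D t x)}"

text \<open>The set \<open>dom_set t\<close> may be a proper subset of the mixed-integer lattice (binary or bounded
  integers, say): a nonnegative affine radius on the whole lattice would have to be constant.\<close>

definition wf_drmsip :: "('n::finite, 'w::finite) drmsip \<Rightarrow> bool" where
  "wf_drmsip D \<longleftrightarrow>
     is_norm (wnorm D) \<and>
     (\<forall>t. dom_set D t \<subseteq> {x. \<forall>j\<in>int_idx D t. x $ j \<in> \<int>}) \<and>
     (\<forall>t\<in>{2..horizon D}.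
        num_samples D t \<ge> 1 \<and>
        (\<forall>i\<in>{1..num_samples D t}. sample D t i \<in> support D t) \<and>
        (\<exists>a b. \<forall>x\<in>dom_set D (t - 1). radius D t x = a \<bullet> x + b) \<and>
        (\<forall>x\<in>dom_set D (t - 1). radius D t x \<ge> 0) \<and>
        (\<forall>x\<in>dom_set D (t - 1). \<forall>w\<in>support D t.
           feasible D t x w \<noteq> {} \<and> compact (feasible D t x w)))"

text \<open>Optimal values are infima in the extended reals. \<open>stage_value D t V\<close> is the stage-\<open>t\<close> problem
  with cost-to-go \<open>V\<close>.\<close>

definition stage_value :: "('n::finite, 'w::finite) drmsip \<Rightarrow> nat \<Rightarrow> (real ^ 'n \<Rightarrow> ereal)
    \<Rightarrow> real ^ 'n \<Rightarrow> real ^ 'w \<Rightarrow> ereal" where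
  "stage_value D t V x w = (INF y\<in>feasible D t x w. ereal (cost D t \<bullet> y) + V y)"

function exp_cost_to_go :: "('n::finite, 'w::finite) drmsip \<Rightarrow> nat \<Rightarrow> real ^ 'n \<Rightarrow> ereal" where
  "exp_cost_to_go D t x =
     (if t > horizon D then 0
      else INF P\<in>ambiguity D t x.
        expect P (\<lambda>w. stage_value D t (\<lambda>y. exp_cost_to_go D (Suc t) y) x w))"
  by pat_completeness auto
termination
  by (relation "Wellfounded.measure (\<lambda>(D, t, x). Suc (horizon D) - t)") auto

declare exp_cost_to_go.simps [simp del]

definition cost_to_go ::
  "('n::finite, 'w::finite) drmsip \<Rightarrow> nat \<Rightarrow> real ^ 'n \<Rightarrow> real ^ 'w \<Rightarrow> ereal" where
  "cost_to_go D t = stage_value D t (exp_cost_to_go D (Suc t))"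

lemma cost_to_go_eq:
  "cost_to_go D t x w = (INF y\<in>feasible D t x w. ereal (cost D t \<bullet> y) + exp_cost_to_go D (t + 1) y)"
  by (simp add: cost_to_go_def stage_value_def)

lemma exp_cost_to_go_eq:
  "t \<le> horizon D \<Longrightarrow> exp_cost_to_go D t x = (INF P\<in>ambiguity D t x. expect P (cost_to_go D t x))"
  by (subst exp_cost_to_go.simps) (simp add: cost_to_go_def)

lemma exp_cost_to_go_terminal: "exp_cost_to_go D (horizon D + 1) x = 0"
  by (simp add: exp_cost_to_go.simps)


subsection \<open>Cuts\<close>

definition valid_cuts ::
  "('n::finite, 'w::finite) drmsip \<Rightarrow> nat \<Rightarrow> nat \<Rightarrow> (nat \<Rightarrow> real ^ 'n) \<Rightarrow> (nat \<Rightarrow> real) \<Rightarrow> bool" where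
  "valid_cuts D t K \<pi> \<gamma> \<longleftrightarrow>
     (\<forall>y\<in>dom_set D t. \<forall>k\<in>{1..K}. exp_cost_to_go D (t + 1) y \<ge> ereal (\<pi> k \<bullet> y + \<gamma> k))"

text \<open>Only the components \<open>1, \<dots>, num_samples t\<close> (and \<open>1, \<dots>, K\<close>) of these families are used.\<close>

record 'w cut_params =
  rho :: real
  lam :: "nat \<Rightarrow> real ^ 'w"
  mu :: "nat \<Rightarrow> real ^ 'w"
  nu :: "nat \<Rightarrow> real ^ 'w"
  zeta :: "nat \<Rightarrow> nat \<Rightarrow> real"

definition cut_system :: "('n::finite, 'w::finite) drmsip \<Rightarrow> nat \<Rightarrow> nat \<Rightarrow> (nat \<Rightarrow> real ^ 'n)
    \<Rightarrow> 'w cut_params \<Rightarrow> bool" where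
  "cut_system D t K \<pi> p \<longleftrightarrow>
     (\<forall>i\<in>{1..num_samples D t}.
        transpose (mat_A D t) *v lam p i - (\<Sum>k=1..K. zeta p i k *\<^sub>R \<pi> k) = cost D t \<and>
        dual_norm (wnorm D) (lam p i - mu p i + nu p i) \<le> rho p \<and>
        (\<Sum>k=1..K. zeta p i k) = 1 \<and>
        (\<forall>j. lam p i $ j \<ge> 0 \<and> mu p i $ j \<ge> 0 \<and> nu p i $ j \<ge> 0) \<and>
        (\<forall>k\<in>{1..K}. zeta p i k \<ge> 0)) \<and>
     rho p \<ge> 0"

definition cut_term :: "('n::finite, 'w::finite) drmsip \<Rightarrow> nat \<Rightarrow> nat \<Rightarrow> (nat \<Rightarrow> real)
    \<Rightarrow> 'w cut_params \<Rightarrow> real ^ 'n \<Rightarrow> nat \<Rightarrow> real" where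
  "cut_term D t K \<gamma> p x i =
     (- lam p i) \<bullet> (mat_C D t *v x) + mu p i \<bullet> lower D t - nu p i \<bullet> upper D t
       + (lam p i - mu p i + nu p i) \<bullet> sample D t i + (\<Sum>k=1..K. zeta p i k * \<gamma> k)"

definition cut_bound :: "('n::finite, 'w::finite) drmsip \<Rightarrow> nat \<Rightarrow> nat \<Rightarrow> (nat \<Rightarrow> real)
    \<Rightarrow> 'w cut_params \<Rightarrow> real ^ 'n \<Rightarrow> real" where
  "cut_bound D t K \<gamma> p x =
     - radius D t x * rho p + (\<Sum>i=1..num_samples D t. 1 / num_samples D t * cut_term D t K \<gamma> p x i)"

definition cut_objective :: "('n::finite, 'w::finite) drmsip \<Rightarrow> nat \<Rightarrow> nat \<Rightarrow> (nat \<Rightarrow> real)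
    \<Rightarrow> real ^ 'n \<Rightarrow> 'w cut_params \<Rightarrow> real" where
  "cut_objective D t K \<gamma> x p =
     - radius D t x * rho p + 1 / num_samples D t * (\<Sum>i=1..num_samples D t. cut_term D t K \<gamma> p x i)"

definition lower_bounds :: "('n::finite, 'w::finite) drmsip \<Rightarrow> nat \<Rightarrow> nat \<Rightarrow> (nat \<Rightarrow> real ^ 'n)
    \<Rightarrow> (nat \<Rightarrow> real) \<Rightarrow> (real ^ 'n \<Rightarrow> real) set" where
  "lower_bounds D t K \<pi> \<gamma> =
     {b. (\<exists>p. cut_system D t K \<pi> p \<and> b = cut_bound D t K \<gamma> p) \<and>
         (\<forall>y\<in>dom_set D (t - 1). exp_cost_to_go D t y \<ge> ereal (b y))}"

end

theory Submission
  imports Defs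
begin

text \<open>
  The cut in (a) comes from dualising twice. For a fixed sample index \<open>i\<close>, the multipliers
  \<open>\<lambda>\<^sup>i, \<zeta>\<^sup>i\<close> are feasible for the dual of the linear programme that results from the stage problem when
  the integrality constraints are dropped and the cost-to-go is replaced by its cuts; weak duality
  bounds the stage value from below by an affine function of \<open>\<omega>\<close> with slope \<open>\<lambda>\<^sup>i\<close>. On the box
  \<open>[l, u]\<close> the multipliers \<open>\<mu>\<^sup>i, \<nu>\<^sup>i\<close> change this slope to \<open>\<lambda>\<^sup>i - \<mu>\<^sup>i + \<nu>\<^sup>i\<close>, whose dual norm is at most
  \<open>\<rho>\<close>. Hence the stage value at \<open>\<omega>\<close> is at least \<open>c\<^sub>i - \<rho> \<parallel>\<omega> - \<omega>\<^sup>i\<parallel>\<close>, where \<open>c\<^sub>i\<close> is the summand of the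
  cut that belongs to sample \<open>i\<close> (\<open>cost_to_go_ge_dual\<close>).

  The maximum \<open>h\<close> of these cones over \<open>i\<close> is still a lower bound, is \<open>\<rho>\<close>-Lipschitz, and satisfies
  \<open>h(\<omega>\<^sup>i) \<ge> c\<^sub>i\<close>. By the elementary direction of Kantorovich duality
  (\<open>wasserstein_lipschitz_integral\<close>), the expectation of \<open>h\<close> under any distribution within Wasserstein
  distance \<open>\<epsilon>\<close> of the empirical one is at least the empirical mean of \<open>h\<close> minus \<open>\<rho> \<epsilon>\<close>, and this is at
  least the value of the cut. Using the one function \<open>h\<close> rather than one cone per sample avoids
  disintegrating a coupling over the sample points, and it is insensitive to repeated samples.

  Part (b) then follows, because by (a) every solution of the system yields a valid bound, and the
  objective at a solution is the value at \<open>x\<close> of its bound.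
\<close>

section \<open>Norms and dual norms on finite-dimensional space\<close>

lemma is_norm_zero: "is_norm N \<Longrightarrow> N 0 = 0"
  by (simp add: is_norm_def)

lemma is_norm_uminus:
  assumes "is_norm N"
  shows "N (- v) = N v"
proof -
  have "N ((-1) *\<^sub>R v) = \<bar>-1\<bar> * N v"
    using assms unfolding is_norm_def by blast
  then show ?thesis by simp
qed

lemma is_norm_minus_commute:
  assumes "is_norm N"
  shows "N (v - w) = N (w - v)"
  using is_norm_uminus[OF assms, of "v - w"] by simp

lemma is_norm_nonneg:
  assumes "is_norm N"
  shows "0 \<le> N v"
proof -
  have "N (v + - v) \<le> N v + N (- v)"
    using assms unfolding is_norm_def by blast
  then show ?thesis
    using is_norm_zero[OF assms] is_norm_uminus[OF assms, of v] by simp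
qed

lemma is_norm_continuous:
  fixes N :: "real ^ 'w::finite \<Rightarrow> real"
  assumes "is_norm N"
  shows "continuous_on UNIV N"
proof (rule convex_on_continuous)
  show "convex_on UNIV N"
  proof (rule convex_onI)
    fix s :: real and v w
    assume s: "0 < s" "s < 1"
    have "N ((1 - s) *\<^sub>R v + s *\<^sub>R w) \<le> N ((1 - s) *\<^sub>R v) + N (s *\<^sub>R w)"
      using assms unfolding is_norm_def by blast
    also have "\<dots> = \<bar>1 - s\<bar> * N v + \<bar>s\<bar> * N w"
      using assms unfolding is_norm_def by simp
    finally show "N ((1 - s) *\<^sub>R v + s *\<^sub>R w) \<le> (1 - s) * N v + s * N w"
      using s by simp
  qed simp
qed simp

text \<open>By compactness of the Euclidean unit sphere. This half of the equivalence of norms makes the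
  unit ball of \<open>N\<close> bounded, so that the supremum that defines the dual norm is finite.\<close>

lemma is_norm_bounds_norm:
  fixes N :: "real ^ 'w::finite \<Rightarrow> real"
  assumes N: "is_norm N"
  obtains m where "m > 0" "\<And>v. m * norm v \<le> N v"
proof -
  have "continuous_on (sphere 0 1) N"
    using is_norm_continuous[OF N] continuous_on_subset by blast
  moreover have "axis undefined 1 \<in> (sphere 0 1 :: (real ^ 'w) set)"
    by simp
  then have "(sphere 0 1 :: (real ^ 'w) set) \<noteq> {}"
    by blast
  ultimately obtain a where a: "a \<in> sphere 0 1" "\<And>v. v \<in> sphere 0 1 \<Longrightarrow> N a \<le> N v"
    using continuous_attains_inf[of "sphere 0 1" N] by (metis compact_sphere)
  have "a \<noteq> 0"
    using a(1) by auto
  then have pos: "N a > 0"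
    using is_norm_nonneg[OF N, of a] N unfolding is_norm_def by (metis less_eq_real_def)
  have "N a * norm v \<le> N v" for v
  proof (cases "v = 0")
    case False
    then have "N a \<le> N ((1 / norm v) *\<^sub>R v)"
      by (intro a(2)) simp
    also have "\<dots> = \<bar>1 / norm v\<bar> * N v"
      using N unfolding is_norm_def by blast
    finally show ?thesis
      using False by (simp add: field_simps)
  qed (simp add: is_norm_zero[OF N])
  then show ?thesis
    using that pos by blast
qed

text \<open>The supremum is over a set of reals, so the inequality depends on this set being bounded
  above: otherwise the supremum would be an unspecified number.\<close>

lemma inner_le_dual_norm:
  fixes N :: "real ^ 'w::finite \<Rightarrow> real"
  assumes N: "is_norm N"
  shows "y \<bullet> z \<le> dual_norm N y * N z"
proof (cases "z = 0")
  case False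
  obtain m where m: "m > 0" "\<And>v. m * norm v \<le> N v"
    using is_norm_bounds_norm[OF N] by blast
  have "y \<bullet> v \<le> norm y * (1 / m)" if "N v \<le> 1" for v
  proof -
    have "m * norm v \<le> 1"
      using m(2)[of v] that by linarith
    then have "norm v \<le> 1 / m"
      using m(1) by (simp add: field_simps)
    then show ?thesis
      using norm_cauchy_schwarz[of y v] mult_left_mono[of "norm v" "1 / m" "norm y"] by simp
  qed
  then have bdd: "bdd_above ((\<lambda>v. y \<bullet> v) ` {v. N v \<le> 1})"
    by (intro bdd_aboveI2) auto
  have pos: "N z > 0"
    using is_norm_nonneg[OF N, of z] N False unfolding is_norm_def by (metis less_eq_real_def)
  have "N ((1 / N z) *\<^sub>R z) = \<bar>1 / N z\<bar> * N z"
    using N unfolding is_norm_def by blast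
  then have "N ((1 / N z) *\<^sub>R z) \<le> 1"
    using pos by simp
  then have "y \<bullet> ((1 / N z) *\<^sub>R z) \<le> dual_norm N y"
    unfolding dual_norm_def by (intro cSUP_upper[OF _ bdd]) simp
  then show ?thesis
    using pos by (simp add: field_simps)
qed (simp add: is_norm_zero[OF N])

section \<open>Lipschitz functions and the Wasserstein distance\<close>

lemma continuous_on_if_norm_lipschitz:
  fixes N :: "real ^ 'w::finite \<Rightarrow> real"
  assumes N: "is_norm N" and lip: "\<And>v w. h v - h w \<le> r * N (v - w)"
  shows "continuous_on UNIV (h :: _ \<Rightarrow> real)"
proof -
  have "(h \<longlongrightarrow> h v) (at v)" for v
  proof -
    have "isCont N 0"
      using is_norm_continuous[OF N] by (simp add: continuous_on_eq_continuous_at)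
    then have "((\<lambda>w. N (w - v)) \<longlongrightarrow> N 0) (at v)"
      using LIM_zero[OF tendsto_ident_at] by (rule isCont_tendsto_compose)
    from tendsto_mult_left[OF this, of r]
    have lim: "((\<lambda>w. r * N (w - v)) \<longlongrightarrow> 0) (at v)"
      by (simp add: is_norm_zero[OF N])
    have "norm (h w - h v) \<le> r * N (w - v)" for w
      unfolding real_norm_def using lip[of w v] lip[of v w, unfolded is_norm_minus_commute[OF N, of v w]]
      by linarith
    then have "((\<lambda>w. h w - h v) \<longlongrightarrow> 0) (at v)"
      by (intro Lim_null_comparison[OF always_eventually lim] allI)
    then show ?thesis
      by (rule LIM_zero_cancel)
  qed
  then show ?thesis
    by (simp add: continuous_on_def)
qed

lemma integrable_continuous_on_compact:
  fixes h :: "'a::euclidean_space \<Rightarrow> real"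
  assumes J: "prob_space M" and S: "compact S" and h: "continuous_on UNIV h"
    and f: "f \<in> borel_measurable M" and AE: "AE z in M. f z \<in> S"
  shows "integrable M (\<lambda>z. h (f z))"
proof -
  interpret prob_space M by fact
  have "bounded (h ` S)"
    using compact_continuous_image[OF continuous_on_subset[OF h] S] compact_imp_bounded by blast
  then obtain B where B: "\<And>w. w \<in> S \<Longrightarrow> \<bar>h w\<bar> \<le> B"
    by (auto simp: bounded_iff)
  show ?thesis
  proof (rule integrable_const_bound)
    show "AE z in M. norm (h (f z)) \<le> B"
      using AE by eventually_elim (simp add: B)
    show "(\<lambda>z. h (f z)) \<in> borel_measurable M"
      using measurable_compose[OF f borel_measurable_continuous_onI[OF h]] .
  qed
qed

text \<open>For a coupling \<open>J\<close>, the difference of the two expectations is the \<open>J\<close>-integral of \<open>h v - h w\<close>,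
  which is at most \<open>r\<close> times the transport cost. The infimum over couplings need not be attained
  here, so the proof takes nearly optimal ones and lets the error \<open>d\<close> tend to 0.\<close>

lemma wasserstein_lipschitz_integral:
  fixes N :: "real ^ 'w::finite \<Rightarrow> real"
  assumes N: "is_norm N" and S: "compact S" and r: "r \<ge> 0" and e: "e \<ge> 0"
    and W: "wasserstein N S P P' \<le> ennreal e"
    and lip: "\<And>v w. h v - h w \<le> r * N (v - w)"
  shows "integral\<^sup>L P' h - r * e \<le> integral\<^sup>L P h"
proof (rule field_le_epsilon)
  fix d :: real
  assume d: "d > 0"
  (* r may be 0, hence r + 1 in the denominator. *)
  define d' where "d' = d / (r + 1)"
  have d': "d' > 0" "r * d' \<le> d"
    using d r by (auto simp: d'_def field_simps)
  have "wasserstein N S P P' < ennreal (e + d')"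
    using W e d' by (metis ennreal_lessI le_less_trans add_nonneg_pos less_add_same_cancel1)
  then obtain J where J: "J \<in> couplings S P P'"
    and cost: "(\<integral>\<^sup>+ z. ennreal (N (fst z - snd z)) \<partial>J) < ennreal (e + d')"
    unfolding wasserstein_def INF_less_iff by blast
  interpret J: prob_space J
    using J by (simp add: couplings_def)
  have sets: "sets J = sets (borel \<Otimes>\<^sub>M borel)"
    and P: "P = distr J borel fst" and P': "P' = distr J borel snd"
    using J by (auto simp: couplings_def)
  have meas: "fst \<in> borel_measurable J" "snd \<in> borel_measurable J"
    unfolding measurable_cong_sets[OF sets refl] by auto
  have h: "continuous_on UNIV h"
    by (rule continuous_on_if_norm_lipschitz[OF N lip])
  have hb: "h \<in> borel_measurable borel"
    by (rule borel_measurable_continuous_onI[OF h])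
  have Sm: "S \<times> S \<in> sets J"
    using S unfolding sets by (auto intro!: pair_measureI borel_closed compact_imp_closed)
  have "emeasure J (S \<times> S) = 1"
    using J by (simp add: couplings_def)
  then have "AE z in J. z \<in> S \<times> S"
    using Sm by (intro J.AE_prob_1) (simp add: measure_def)
  then have AE: "AE z in J. fst z \<in> S" "AE z in J. snd z \<in> S"
    by (auto elim!: eventually_mono)
  have int: "integrable J (\<lambda>z. h (fst z))" "integrable J (\<lambda>z. h (snd z))"
    using integrable_continuous_on_compact[OF J.prob_space_axioms S h] meas AE by blast+
  have Nb: "N \<in> borel_measurable borel"
    by (rule borel_measurable_continuous_onI[OF is_norm_continuous[OF N]])
  have mN: "(\<lambda>z. N (fst z - snd z)) \<in> borel_measurable J"
    using measurable_compose[OF borel_measurable_diff[OF meas] Nb] .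
  have intN: "integrable J (\<lambda>z. N (fst z - snd z))"
    using mN cost by (intro integrableI_nonneg) (auto simp: is_norm_nonneg[OF N] top.not_eq_extremum
        intro: order.strict_trans)
  have "ennreal (LINT z|J. N (fst z - snd z)) < ennreal (e + d')"
    using nn_integral_eq_integral[OF intN] cost by (simp add: is_norm_nonneg[OF N])
  then have le: "(LINT z|J. N (fst z - snd z)) \<le> e + d'"
    by (subst (asm) ennreal_less_iff) (simp_all add: is_norm_nonneg[OF N])
  have "(LINT z|J. h (snd z)) - (LINT z|J. h (fst z)) = (LINT z|J. h (snd z) - h (fst z))"
    using int by simp
  also have "\<dots> \<le> (LINT z|J. r * N (fst z - snd z))"
    using int intN lip is_norm_minus_commute[OF N]
    by (intro integral_mono) (auto, metis)
  also have "\<dots> = r * (LINT z|J. N (fst z - snd z))"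
    by simp
  also have "\<dots> \<le> r * (e + d')"
    using le r by (rule mult_left_mono)
  also have "\<dots> \<le> r * e + d"
    using d' by (simp add: algebra_simps)
  finally show "integral\<^sup>L P' h - r * e \<le> integral\<^sup>L P h + d"
    unfolding P P' using integral_distr[OF meas(1) hb] integral_distr[OF meas(2) hb] by simp
qed

lemma integral_empirical:
  assumes "h \<in> borel_measurable borel"
  shows "integral\<^sup>L (empirical n w) h = (\<Sum>i=1..n. 1 / n * (h (w i) :: real))"
proof -
  have "integral\<^sup>L (empirical n w) h = (LINT i|uniform_count_measure {1..n}. h (w i))"
    unfolding empirical_def using assms
    by (intro integral_distr) (auto simp: measurable_def space_uniform_count_measure sets_uniform_count_measure)
  then show ?thesis
    by (simp add: uniform_count_measure_def lebesgue_integral_point_measure_finite)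
qed

text \<open>Stage value functions are infima over sets that vary with the random vector, so their
  measurability is not evident; the lower integral that underlies \<^const>\<open>expect\<close> is monotone for all functions.\<close>

lemma expect_ge_integral:
  assumes int: "integrable P h" and ge: "AE w in P. ereal (h w) \<le> f w"
  shows "ereal (integral\<^sup>L P h) \<le> expect P f"
proof -
  have "AE w in P. e2ennreal (ereal (h w)) \<le> e2ennreal (f w)"
    using ge by eventually_elim (rule e2ennreal_mono)
  then have "(\<integral>\<^sup>+ w. e2ennreal (ereal (h w)) \<partial>P) \<le> (\<integral>\<^sup>+ w. e2ennreal (f w) \<partial>P)"
    by (rule nn_integral_mono_AE)
  moreover have "AE w in P. e2ennreal (- f w) \<le> e2ennreal (- ereal (h w))"
    using ge by eventually_elim (rule e2ennreal_mono, simp only: ereal_minus_le_minus)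
  then have "(\<integral>\<^sup>+ w. e2ennreal (- f w) \<partial>P) \<le> (\<integral>\<^sup>+ w. e2ennreal (- ereal (h w)) \<partial>P)"
    by (rule nn_integral_mono_AE)
  ultimately have "expect P (\<lambda>w. ereal (h w)) \<le> expect P f"
    unfolding expect_def by (intro ereal_minus_mono) (simp_all add: less_eq_ennreal.rep_eq)
  then show ?thesis
    by (simp add: expect_eq_integral[OF int])
qed

section \<open>Weak duality for the stage problem\<close>

lemma inner_vec_nonneg:
  fixes a b :: "real ^ 'w::finite"
  assumes "\<And>j. 0 \<le> a $ j" and "\<And>j. 0 \<le> b $ j"
  shows "0 \<le> a \<bullet> b"
  using assms by (simp add: inner_vec_def sum_nonneg)

text \<open>Weak duality. Convexly combining the cuts with weights \<open>\<zeta>\<close> and using the equation of the system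
  gives \<open>c \<bullet> y + V y \<ge> \<lambda> \<bullet> A y + \<zeta> \<bullet> \<gamma> \<ge> \<lambda> \<bullet> (w - C x) + \<zeta> \<bullet> \<gamma>\<close> for every feasible \<open>y\<close>. Since \<open>w\<close> lies in
  the box, subtracting \<open>\<mu> \<bullet> (w - l)\<close> and \<open>\<nu> \<bullet> (u - w)\<close> only decreases the right-hand side. What is left
  is affine in \<open>w\<close> with slope \<open>\<lambda> - \<mu> + \<nu>\<close> and value \<open>cut_term\<close> at the sample point.\<close>

lemma cost_to_go_ge_dual:
  assumes N: "is_norm (wnorm D)" and K: "K \<ge> 1" and cuts: "valid_cuts D t K \<pi> \<gamma>"
    and p: "cut_system D t K \<pi> p" and i: "i \<in> {1..num_samples D t}"
    and w: "w \<in> support D t"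
  shows "ereal (cut_term D t K \<gamma> p x i - rho p * wnorm D (w - sample D t i)) \<le> cost_to_go D t x w"
  unfolding cost_to_go_eq
proof (rule INF_greatest)
  fix y
  assume y: "y \<in> feasible D t x w"
  define V where "V = exp_cost_to_go D (t + 1) y"
  define L where "L = lam p i"
  define M where "M = mu p i"
  define U where "U = nu p i"
  define Z where "Z = zeta p i"
  have sys: "transpose (mat_A D t) *v L - (\<Sum>k=1..K. Z k *\<^sub>R \<pi> k) = cost D t"
    "dual_norm (wnorm D) (L - M + U) \<le> rho p" "(\<Sum>k=1..K. Z k) = 1"
    "\<And>j. L $ j \<ge> 0" "\<And>j. M $ j \<ge> 0" "\<And>j. U $ j \<ge> 0" "\<And>k. k \<in> {1..K} \<Longrightarrow> Z k \<ge> 0"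
    using p i unfolding cut_system_def L_def M_def U_def Z_def by blast+
  have cut: "ereal (\<pi> k \<bullet> y + \<gamma> k) \<le> V" if "k \<in> {1..K}" for k
    using cuts y that by (auto simp: valid_cuts_def feasible_def V_def)
  have "ereal (cut_term D t K \<gamma> p x i - rho p * wnorm D (w - sample D t i)) \<le> ereal (cost D t \<bullet> y) + V"
  proof (cases V)
    case (real v)
    have "(\<Sum>k=1..K. Z k * (\<pi> k \<bullet> y + \<gamma> k)) \<le> (\<Sum>k=1..K. Z k * v)"
      using cut sys(7) real by (intro sum_mono mult_left_mono) auto
    also have "\<dots> = v"
      unfolding sum_distrib_right[symmetric] sys(3) by simp
    finally have v: "(\<Sum>k=1..K. Z k *\<^sub>R \<pi> k) \<bullet> y + (\<Sum>k=1..K. Z k * \<gamma> k) \<le> v"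
      by (simp add: inner_sum_left sum.distrib algebra_simps)
    have "0 \<le> L \<bullet> (mat_A D t *v y - (w - mat_C D t *v x))"
      using y sys(4) by (intro inner_vec_nonneg) (auto simp: feasible_def)
    moreover have "0 \<le> M \<bullet> (w - lower D t)" "0 \<le> U \<bullet> (upper D t - w)"
      using w sys(5,6) by (auto intro!: inner_vec_nonneg simp: support_def)
    moreover have "(transpose (mat_A D t) *v L) \<bullet> y = L \<bullet> (mat_A D t *v y)"
      by (simp add: dot_lmul_matrix flip: vector_transpose_matrix)
    moreover have "(L - M + U) \<bullet> (sample D t i - w) \<le> rho p * wnorm D (w - sample D t i)"
      unfolding is_norm_minus_commute[OF N, of w "sample D t i"]
      using inner_le_dual_norm[OF N] mult_right_mono[OF sys(2) is_norm_nonneg[OF N]]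
      by (rule order_trans)
    moreover have "cost D t \<bullet> y = (transpose (mat_A D t) *v L) \<bullet> y - (\<Sum>k=1..K. Z k *\<^sub>R \<pi> k) \<bullet> y"
      by (simp add: inner_diff_left flip: sys(1))
    ultimately have "cut_term D t K \<gamma> p x i - rho p * wnorm D (w - sample D t i) \<le> cost D t \<bullet> y + v"
      using v unfolding cut_term_def L_def[symmetric] M_def[symmetric] U_def[symmetric] Z_def[symmetric]
      by (simp add: inner_diff_left inner_diff_right inner_add_left inner_add_right)
    then show ?thesis
      by (simp add: real)
  next
    case MInf
    then show ?thesis
      using cut[of 1] K by simp
  qed simp
  then show "ereal (cut_term D t K \<gamma> p x i - rho p * wnorm D (w - sample D t i))
      \<le> ereal (cost D t \<bullet> y) + exp_cost_to_go D (t + 1) y"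
    by (simp add: V_def)
qed

section \<open>Validity of the cuts\<close>

lemma compact_support: "compact (support D t)"
proof -
  have "support D t = cbox (lower D t) (upper D t)"
    by (auto simp: support_def mem_box_cart)
  then show ?thesis
    by simp
qed

text \<open>The expectation of \<open>h\<close>, the maximum over the samples of the cones from \<open>cost_to_go_ge_dual\<close>,
  lies between the cut and the expected cost-to-go, for every distribution in the ambiguity set.\<close>

lemma cut_bound_le_exp_cost_to_go:
  fixes D :: "('n::finite, 'w::finite) drmsip"
  assumes wf: "wf_drmsip D" and t: "t \<in> {2..horizon D}" and K: "K \<ge> 1"
    and cuts: "valid_cuts D t K \<pi> \<gamma>" and p: "cut_system D t K \<pi> p"
    and x: "x \<in> dom_set D (t - 1)"
  shows "ereal (cut_bound D t K \<gamma> p x) \<le> exp_cost_to_go D t x"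
proof -
  define n where "n = num_samples D t"
  define s where "s = sample D t"
  define N where "N = wnorm D"
  define c where "c = cut_term D t K \<gamma> p x"
  define h where "h = (\<lambda>w. Max ((\<lambda>i. c i - rho p * N (w - s i)) ` {1..n}))"
  have N: "is_norm N" and n: "n \<ge> 1" and rad: "radius D t x \<ge> 0" and r: "rho p \<ge> 0"
    using wf t x p by (auto simp: wf_drmsip_def N_def n_def cut_system_def)
  have ne: "{1..n} \<noteq> {}"
    using n by simp
  have h_ge: "c i - rho p * N (w - s i) \<le> h w" if "i \<in> {1..n}" for i w
    unfolding h_def using that by (intro Max_ge) auto
  have lip: "h v - h w \<le> rho p * N (v - w)" for v w
  proof -
    have "c i - rho p * N (v - s i) \<le> h w + rho p * N (v - w)" if i: "i \<in> {1..n}" for i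
    proof -
      have "N ((w - v) + (v - s i)) \<le> N (w - v) + N (v - s i)"
        using N unfolding is_norm_def by blast
      then have "N (w - s i) \<le> N (v - w) + N (v - s i)"
        using is_norm_minus_commute[OF N, of v w] by simp
      then have "rho p * N (w - s i) \<le> rho p * N (v - w) + rho p * N (v - s i)"
        using r by (metis mult_left_mono distrib_left)
      then show ?thesis
        using h_ge[OF i, of w] by linarith
    qed
    then have "h v \<le> h w + rho p * N (v - w)"
      unfolding h_def using ne by (subst Max_le_iff) auto
    then show ?thesis by simp
  qed
  have hc: "continuous_on UNIV h"
    by (rule continuous_on_if_norm_lipschitz[OF N lip])
  have h_le: "ereal (h w) \<le> cost_to_go D t x w" if w: "w \<in> support D t" for w
  proof -
    have "h w \<in> (\<lambda>i. c i - rho p * N (w - s i)) ` {1..n}"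
      unfolding h_def using ne by (intro Max_in) auto
    then show ?thesis
      using cost_to_go_ge_dual[OF N[unfolded N_def] K cuts p _ w]
      by (auto simp: c_def N_def s_def n_def)
  qed
  have "ereal (cut_bound D t K \<gamma> p x) \<le> expect P (cost_to_go D t x)" if P: "P \<in> ambiguity D t x" for P
  proof -
    have ps: "prob_space P" and sets: "sets P = sets borel" and one: "emeasure P (support D t) = 1"
      and W: "wasserstein N (support D t) P (empirical n s) \<le> ennreal (radius D t x)"
      using P by (auto simp: ambiguity_def distributions_on_def N_def n_def s_def)
    interpret P: prob_space P by fact
    have AE: "AE w in P. w \<in> support D t"
      using one sets borel_compact[OF compact_support, of D t]
      by (intro P.AE_prob_1) (simp add: measure_def)
    have int: "integrable P h"
      using integrable_continuous_on_compact[OF ps compact_support hc, of "\<lambda>w. w"] AE sets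
      by (simp add: measurable_ident_sets)
    have "cut_bound D t K \<gamma> p x = (\<Sum>i=1..n. 1 / n * c i) - rho p * radius D t x"
      by (simp add: cut_bound_def n_def c_def)
    also have "\<dots> \<le> (\<Sum>i=1..n. 1 / n * h (s i)) - rho p * radius D t x"
    proof -
      have "c i \<le> h (s i)" if "i \<in> {1..n}" for i
        using h_ge[OF that, of "s i"] by (simp add: is_norm_zero[OF N])
      then show ?thesis
        by (intro diff_right_mono sum_mono mult_left_mono) auto
    qed
    also have "\<dots> = integral\<^sup>L (empirical n s) h - rho p * radius D t x"
      using integral_empirical[OF borel_measurable_continuous_onI[OF hc]] by simp
    also have "\<dots> \<le> integral\<^sup>L P h"
      by (rule wasserstein_lipschitz_integral[OF N compact_support r rad W lip])
    finally have "ereal (cut_bound D t K \<gamma> p x) \<le> ereal (integral\<^sup>L P h)"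
      by simp
    also have "\<dots> \<le> expect P (cost_to_go D t x)"
      using AE by (intro expect_ge_integral[OF int]) (auto elim!: eventually_mono intro: h_le)
    finally show ?thesis .
  qed
  then show ?thesis
    using t by (auto simp: exp_cost_to_go_eq intro!: INF_greatest)
qed

theorem theorem2:
  fixes D :: "('n::finite, 'w::finite) drmsip"
    and t K :: nat
    and \<pi> :: "nat \<Rightarrow> real ^ 'n"
    and \<gamma> :: "nat \<Rightarrow> real"
  assumes "wf_drmsip D"
    and "t \<in> {2..horizon D}"
    and "K \<ge> 1"
    and "valid_cuts D t K \<pi> \<gamma>"
  shows "(\<forall>p. cut_system D t K \<pi> p \<longrightarrow>
            (\<forall>x\<in>dom_set D (t - 1). exp_cost_to_go D t x \<ge> ereal (cut_bound D t K \<gamma> p x))) \<and>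
         (\<forall>x\<in>dom_set D (t - 1).
            (SUP p\<in>{p. cut_system D t K \<pi> p}. ereal (cut_objective D t K \<gamma> x p))
              = (SUP b\<in>lower_bounds D t K \<pi> \<gamma>. ereal (b x)) \<and>
            {cut_bound D t K \<gamma> p | p. is_arg_max (cut_objective D t K \<gamma> x) (cut_system D t K \<pi>) p}
              = {b \<in> lower_bounds D t K \<pi> \<gamma>. \<forall>b'\<in>lower_bounds D t K \<pi> \<gamma>. b' x \<le> b x})"
proof -
  note valid = cut_bound_le_exp_cost_to_go[OF assms]
  have bounds: "lower_bounds D t K \<pi> \<gamma> = cut_bound D t K \<gamma> ` {p. cut_system D t K \<pi> p}"
    using valid by (auto simp: lower_bounds_def)
  have obj: "cut_objective D t K \<gamma> x p = cut_bound D t K \<gamma> p x" for x p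
    by (simp add: cut_objective_def cut_bound_def sum_distrib_left)
  show ?thesis
    using valid by (auto simp: bounds obj image_image is_arg_max_def not_less)
qed

end
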